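(* Each space that is productively Menger in the class of hereditarily Lindel\"of spaces is, for all ultrafilters $U$ with $\mathfrak{b}(U)=\mathfrak{d}$, productively $U$-Menger in the class of hereditarily Lindel\"of spaces.
   Context: A space is an infinite Tychonoff topological space. An ultrafilter means a free ultrafilter on $\omega$. Let $[\omega]^\omega$ be the family of infinite subsets of $\omega$; each $a\in[\omega]^\omega$ is identified with its increasing enumeration, so $a(n)$ denotes the $n$-th element of $a$ (starting from $n=0$). For $a,b\in[\omega]^\omega$ write $a\leq_U b$ if $\{n : a(n)\leq b(n)\}\in U$. A set $A\subseteq[\omega]^\omega$ is $\leq_U$-bounded if there is $b\in[\omega]^\omega$ with $a\leq_U b$ for all $a\in A$, and $\leq_U$-unbounded otherwise. $\mathfrak{b}(U)$ is the minimal cardinality of a $\leq_U$-unbounded subset of $[\omega]^\omega$. $\mathfrak{d}$ is the dominating number. A space $X$ is Menger (respectively $U$-Menger) if for every sequence $\mathcal{U}_0,\mathcal{U}_1,\dots$ of open covers of $X$ there are finite sets $\mathcal{F}_0\subseteq\mathcal{U}_0,\mathcal{F}_1\subseteq\mathcal{U}_1,\dots$ such that the family $\{\bigcup\mathcal{F}_n : n\in\omega\}$ covers $X$ (respectively, such that $\{n : x\in\bigcup\mathcal{F}_n\}\in U$ for all $x\in X$). For a topological property $\mathbf{P}$, a space $X$ is productively $\mathbf{P}$ in a given class of spaces if for every space $Y$ from this class with the property $\mathbf{P}$, the product space $X\times Y$ has the property $\mathbf{P}$. *)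

theory Defs
  imports "HOL-Analysis.Analysis"
begin

unbundle cardinal_syntax

definition infinite_Tychonoff_space :: "'a topology \<Rightarrow> bool" where
  "infinite_Tychonoff_space X \<longleftrightarrow>
     infinite (topspace X) \<and> completely_regular_space X \<and> Hausdorff_space X"

definition hereditarily_Lindelof_space :: "'a topology \<Rightarrow> bool" where
  "hereditarily_Lindelof_space X \<longleftrightarrow>
     (\<forall>S. S \<subseteq> topspace X \<longrightarrow> Lindelof_space (subtopology X S))"

text \<open>Ultrafilters are represented as library filters: a set \<open>A\<close> belongs to \<open>U\<close> iff
  \<open>\<forall>\<^sub>F n in U. n \<in> A\<close>.  Freeness is \<open>U \<le> cofinite\<close>, i.e. every cofinite set belongs to \<open>U\<close>.\<close>

definition free_ultrafilter :: "nat filter \<Rightarrow> bool" where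
  "free_ultrafilter U \<longleftrightarrow>
     U \<noteq> bot \<and> (\<forall>P. eventually P U \<or> eventually (\<lambda>n. \<not> P n) U) \<and> U \<le> cofinite"

definition le_U :: "nat filter \<Rightarrow> nat set \<Rightarrow> nat set \<Rightarrow> bool" where
  "le_U U a b \<longleftrightarrow> (\<forall>\<^sub>F n in U. enumerate a n \<le> enumerate b n)"

definition U_bounded :: "nat filter \<Rightarrow> nat set set \<Rightarrow> bool" where
  "U_bounded U A \<longleftrightarrow> (\<exists>b. infinite b \<and> (\<forall>a\<in>A. le_U U a b))"

definition U_unbounded :: "nat filter \<Rightarrow> nat set set \<Rightarrow> bool" where
  "U_unbounded U A \<longleftrightarrow> (\<forall>a\<in>A. infinite a) \<and> \<not> U_bounded U A"

definition dominating :: "(nat \<Rightarrow> nat) set \<Rightarrow> bool" where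
  "dominating D \<longleftrightarrow> (\<forall>f. \<exists>g\<in>D. \<forall>\<^sub>F n in sequentially. f n \<le> g n)"

text \<open>The least cardinality of a set satisfying \<open>P\<close>, as a cardinal order in the sense of
  \<open>BNF_Cardinal_Order_Relation\<close>; it is determined up to \<open>=o\<close>, and equality of cardinals is
  always expressed by \<open>=o\<close>.  It is meaningful only if some set satisfies \<open>P\<close>.\<close>

definition min_card :: "('a set \<Rightarrow> bool) \<Rightarrow> 'a rel" where
  "min_card P = |SOME A. P A \<and> (\<forall>B. P B \<longrightarrow> |A| \<le>o |B| )|"

definition b_U :: "nat filter \<Rightarrow> nat set rel" where
  "b_U U = min_card (U_unbounded U)"

definition dominating_number :: "(nat \<Rightarrow> nat) rel" where
  "dominating_number = min_card dominating"

lemma min_card: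
  assumes "P A0"
  shows "\<exists>A. P A \<and> min_card P = |A| \<and> (\<forall>B. P B \<longrightarrow> |A| \<le>o |B| )"
proof -
  have "\<exists>r\<in>{|A| |A. P A}. \<forall>r'\<in>{|A| |A. P A}. r \<le>o r'"
    using assms by (intro exists_minim_Card_order) (auto simp: card_of_Card_order)
  then have "\<exists>A. P A \<and> (\<forall>B. P B \<longrightarrow> |A| \<le>o |B| )" by blast
  from someI_ex[OF this] show ?thesis unfolding min_card_def by blast
qed

lemma dominating_UNIV: "dominating UNIV"
  unfolding dominating_def by (meson UNIV_I always_eventually order_refl)

lemma enumerate_image_Suc:
  assumes "infinite b"
  shows "enumerate (Suc ` b) n = Suc (enumerate b n)"
proof (induction n)
  case 0
  have "(LEAST m. m \<in> Suc ` b) = Suc (LEAST m. m \<in> b)"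
    using enumerate_in_set[OF assms, of 0]
    by (intro Least_equality) (auto simp: enumerate_0 intro: Least_le)
  then show ?case by (simp add: enumerate_0)
next
  case (Suc n)
  have inf: "infinite (Suc ` b)"
    using assms by (simp add: finite_image_iff)
  have ex: "\<exists>m. m \<in> b \<and> enumerate b n < m"
    using assms by (meson enumerate_in_set enumerate_step)
  have "(LEAST m. m \<in> Suc ` b \<and> Suc (enumerate b n) < m) =
        Suc (LEAST m. m \<in> b \<and> enumerate b n < m)"
    using LeastI_ex[OF ex] by (intro Least_equality) (auto intro: Least_le)
  then show ?case
    using assms inf Suc by (simp add: enumerate_Suc'')
qed

lemma U_unbounded_all_infinite:
  assumes "free_ultrafilter U"
  shows "U_unbounded U {a. infinite a}"
proof -
  have "\<not> U_bounded U {a. infinite a}"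
  proof
    assume "U_bounded U {a. infinite a}"
    then obtain b where b: "infinite b" "\<And>a. infinite a \<Longrightarrow> le_U U a b"
      unfolding U_bounded_def by blast
    have "infinite (Suc ` b)"
      using b(1) by (simp add: finite_image_iff)
    then have "le_U U (Suc ` b) b" by (rule b(2))
    then have "eventually (\<lambda>n. False) U"
      by (simp add: le_U_def enumerate_image_Suc[OF b(1)])
    then show False
      using assms by (simp add: free_ultrafilter_def trivial_limit_def)
  qed
  then show ?thesis by (simp add: U_unbounded_def)
qed

definition open_cover :: "'a topology \<Rightarrow> 'a set set \<Rightarrow> bool" where
  "open_cover X \<C> \<longleftrightarrow> (\<forall>V\<in>\<C>. openin X V) \<and> \<Union>\<C> = topspace X"

definition Menger_space :: "'a topology \<Rightarrow> bool" where
  "Menger_space X \<longleftrightarrow>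
     (\<forall>\<C> :: nat \<Rightarrow> 'a set set. (\<forall>n. open_cover X (\<C> n)) \<longrightarrow>
        (\<exists>\<F>. (\<forall>n. finite (\<F> n) \<and> \<F> n \<subseteq> \<C> n) \<and>
              (\<forall>x\<in>topspace X. \<exists>n. x \<in> \<Union>(\<F> n))))"

definition U_Menger_space :: "nat filter \<Rightarrow> 'a topology \<Rightarrow> bool" where
  "U_Menger_space U X \<longleftrightarrow>
     (\<forall>\<C> :: nat \<Rightarrow> 'a set set. (\<forall>n. open_cover X (\<C> n)) \<longrightarrow>
        (\<exists>\<F>. (\<forall>n. finite (\<F> n) \<and> \<F> n \<subseteq> \<C> n) \<and>
              (\<forall>x\<in>topspace X. \<forall>\<^sub>F n in U. x \<in> \<Union>(\<F> n))))"

text \<open>The type argument \<open>'b\<close> is the type of the points of the second factor \<open>Y\<close>, since a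
  formula cannot quantify over types.  A hereditarily Lindelof Hausdorff space has
  cardinality at most that of the continuum (de Groot), so every hereditarily Lindelof space is
  homeomorphic to some \<open>Y :: real topology\<close>.  As all properties below are
  homeomorphism invariant, \<open>TYPE(real)\<close> gives the unrestricted notion: it ranges over
  all hereditarily Lindelof spaces, not only over subspaces of the real line (the topology of \<open>Y\<close>
  is arbitrary).  A free type variable \<open>'b\<close> in a conclusion covers all second factors
  directly.\<close>

definition productively_Menger_in_hL :: "'b itself \<Rightarrow> 'a topology \<Rightarrow> bool" where
  "productively_Menger_in_hL (_ :: 'b itself) X \<longleftrightarrow>
     (\<forall>Y :: 'b topology.
        infinite_Tychonoff_space Y \<and> hereditarily_Lindelof_space Y \<and> Menger_space Y \<longrightarrow>
        Menger_space (prod_topology X Y))"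

definition productively_U_Menger_in_hL ::
  "'b itself \<Rightarrow> nat filter \<Rightarrow> 'a topology \<Rightarrow> bool" where
  "productively_U_Menger_in_hL (_ :: 'b itself) U X \<longleftrightarrow>
     (\<forall>Y :: 'b topology.
        infinite_Tychonoff_space Y \<and> hereditarily_Lindelof_space Y \<and> U_Menger_space U Y \<longrightarrow>
        U_Menger_space U (prod_topology X Y))"

end

theory Submission
  imports Defs
begin

text \<open>A hereditarily Lindelof Hausdorff space has at most continuum many points (de Groot), so that
  second factors of arbitrary type may be used.  Suppose \<open>Y\<close> is \<open>U\<close>-Menger.  Then
  \<open>X \<times> Y\<close> is Menger, hence Lindelof, and a sequence of open covers turns into functions
  \<open>f p :: nat \<Rightarrow> nat\<close>, which may be taken nondecreasing; it has to be shown that they are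
  \<open>\<le>\<^sub>U\<close>-bounded.  Otherwise, let \<open>D\<close> be a dominating family of least cardinality, well-ordered
  in its initial order type.  Since \<open>b(U) = |D|\<close>, every \<open>d \<in> D\<close> has a \<open>\<le>\<^sub>U\<close>-bound \<open>e d\<close> of its
  predecessors, and there is \<open>p d = (x\<^sub>d, y\<^sub>d)\<close> such that \<open>f (p d) n\<close> exceeds all \<open>d i\<close>, \<open>i \<le> e d n\<close>,
  for \<open>U\<close>-many \<open>n\<close>.  By monotonicity the set \<open>S d\<close> where \<open>d < f (p d)\<close> contains the interval
  \<open>[n, e d n)\<close> for \<open>U\<close>-many \<open>n\<close>.  Let \<open>Z\<close> consist of the pairs \<open>(y, A)\<close> with \<open>A\<close> cofinite and the pairs
  \<open>(y\<^sub>d, S d)\<close>, as a subspace of \<open>Y\<close> times the Cantor set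
  (sets are encoded by their indicator functions).  The \<open>U\<close>-Menger property of \<open>Y\<close> lets one
  cover all pairs containing \<open>[n, h n)\<close> for \<open>U\<close>-many \<open>n\<close>, which leaves less than \<open>|D|\<close> points of \<open>Z\<close>;
  so \<open>Z\<close> is Menger.  But \<open>X \<times> Z\<close> is not Menger, because \<open>f (p d)\<close> dominates \<open>d\<close> on \<open>S d\<close>.\<close>

section \<open>Hereditarily Lindelof and Menger spaces\<close>

text \<open>A family of open sets covers the subspace given by its union. Conversely, relatively
  open sets are traces of open sets of \<open>X\<close>, so a countable subfamily upstairs restricts
  to one of the traces.\<close>

lemma hereditarily_Lindelof_space_alt:
  "hereditarily_Lindelof_space X \<longleftrightarrow>
     (\<forall>\<U>. (\<forall>V\<in>\<U>. openin X V) \<longrightarrow> (\<exists>\<V>. countable \<V> \<and> \<V> \<subseteq> \<U> \<and> \<Union>\<V> = \<Union>\<U>))"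
  (is "_ \<longleftrightarrow> ?R")
proof
  assume hL: "hereditarily_Lindelof_space X"
  show ?R
  proof (intro allI impI)
    fix \<U> assume \<U>: "\<forall>V\<in>\<U>. openin X V"
    then have sub: "\<Union>\<U> \<subseteq> topspace X"
      using openin_subset by blast
    then have "Lindelof_space (subtopology X (\<Union>\<U>))"
      using hL by (simp add: hereditarily_Lindelof_space_def)
    moreover have "\<And>V. V \<in> \<U> \<Longrightarrow> openin (subtopology X (\<Union>\<U>)) V"
      using \<U> by (metis Sup_upper openin_subset_topspace_eq openin_subtopology_Int2 inf.absorb_iff2)
    moreover have "\<Union>\<U> = topspace (subtopology X (\<Union>\<U>))"
      using sub by (auto simp: topspace_subtopology)
    ultimately show "\<exists>\<V>. countable \<V> \<and> \<V> \<subseteq> \<U> \<and> \<Union>\<V> = \<Union>\<U>"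
      using Lindelof_spaceD by metis
  qed
next
  assume R: ?R
  show "hereditarily_Lindelof_space X"
    unfolding hereditarily_Lindelof_space_def Lindelof_space_def
  proof (intro allI impI)
    fix S \<U>
    assume S: "S \<subseteq> topspace X"
      and \<U>: "(\<forall>U\<in>\<U>. openin (subtopology X S) U) \<and> \<Union>\<U> = topspace (subtopology X S)"
    then have "\<forall>U\<in>\<U>. \<exists>T. openin X T \<and> U = T \<inter> S"
      by (auto simp: openin_subtopology)
    then obtain t where t: "\<And>U. U \<in> \<U> \<Longrightarrow> openin X (t U) \<and> U = t U \<inter> S"
      by metis
    then obtain \<V> where \<V>: "countable \<V>" "\<V> \<subseteq> t ` \<U>" "\<Union>\<V> = \<Union>(t ` \<U>)"
      using R[THEN spec, of "t ` \<U>"] by (auto 4 4)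
    then obtain \<W> where \<W>: "countable \<W>" "\<W> \<subseteq> \<U>" "\<V> = t ` \<W>"
      by (metis countable_subset_image)
    have "\<Union>\<W> = \<Union>\<U>"
    proof
      show "\<Union>\<W> \<subseteq> \<Union>\<U>" using \<W> by auto
      show "\<Union>\<U> \<subseteq> \<Union>\<W>"
      proof
        fix x assume "x \<in> \<Union>\<U>"
        then obtain U where U: "U \<in> \<U>" "x \<in> U" by auto
        then have "x \<in> S" "x \<in> \<Union>(t ` \<U>)" using t by blast+
        then obtain W where "W \<in> \<W>" "x \<in> t W" using \<V>(3) \<W>(3) by blast
        then show "x \<in> \<Union>\<W>" using t \<W>(2) \<open>x \<in> S\<close> by blast
      qed
    qed
    then show "\<exists>\<V>. countable \<V> \<and> \<V> \<subseteq> \<U> \<and> \<Union>\<V> = topspace (subtopology X S)"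
      using \<W> \<U> by metis
  qed
qed

lemma hereditarily_Lindelof_space_UN:
  assumes "hereditarily_Lindelof_space X" "\<And>i. i \<in> I \<Longrightarrow> openin X (V i)"
  obtains J where "countable J" "J \<subseteq> I" "(\<Union>i\<in>J. V i) = (\<Union>i\<in>I. V i)"
proof -
  have "\<exists>\<V>. countable \<V> \<and> \<V> \<subseteq> V ` I \<and> \<Union>\<V> = \<Union>(V ` I)"
    using assms unfolding hereditarily_Lindelof_space_alt by simp
  then obtain \<V> where \<V>: "countable \<V>" "\<V> \<subseteq> V ` I" "\<Union>\<V> = \<Union>(V ` I)"
    by metis
  have "\<exists>J. countable J \<and> J \<subseteq> I \<and> \<V> = V ` J"
    using \<V>(1,2) by (metis countable_subset_image)
  then show thesis using that \<V>(3) by metis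
qed

lemma hereditarily_Lindelof_space_subtopology:
  "hereditarily_Lindelof_space X \<Longrightarrow> hereditarily_Lindelof_space (subtopology X S)"
  by (auto simp: hereditarily_Lindelof_space_def subtopology_subtopology topspace_subtopology inf.absorb2)

lemma hereditarily_Lindelof_imp_Lindelof_space:
  "hereditarily_Lindelof_space X \<Longrightarrow> Lindelof_space X"
  by (metis hereditarily_Lindelof_space_def order_refl subtopology_topspace)

text \<open>For each \<open>B\<close> in a countable base, the open \<open>N\<close> for which
  \<open>N \<times> B\<close> fits into a member of the family can be thinned out to countably many
  with the same union. The members chosen for them, over all \<open>B\<close>, are countably many
  and still cover.\<close>

lemma hereditarily_Lindelof_space_prod_second_countable:
  fixes X :: "'a topology"
  assumes "hereditarily_Lindelof_space X"
  shows "hereditarily_Lindelof_space (prod_topology X (euclidean :: 'b::second_countable_topology topology))"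
  unfolding hereditarily_Lindelof_space_alt
proof (intro allI impI)
  fix \<U> assume \<U>: "\<forall>V\<in>\<U>. openin (prod_topology X (euclidean :: 'b topology)) V"
  obtain \<B> :: "'b set set" where \<B>: "countable \<B>" "topological_basis \<B>"
    using ex_countable_basis by blast
  define \<N> where "\<N> B = {N. openin X N \<and> (\<exists>V\<in>\<U>. N \<times> B \<subseteq> V)}" for B
  have "\<exists>\<M>. countable \<M> \<and> \<M> \<subseteq> \<N> B \<and> \<Union>\<M> = \<Union>(\<N> B)" for B
    using assms unfolding hereditarily_Lindelof_space_alt by (simp add: \<N>_def)
  then obtain \<M> where \<M>: "\<And>B. countable (\<M> B)" "\<And>B. \<M> B \<subseteq> \<N> B" "\<And>B. \<Union>(\<M> B) = \<Union>(\<N> B)"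
    by metis
  have "\<forall>B. \<forall>N\<in>\<M> B. \<exists>V\<in>\<U>. N \<times> B \<subseteq> V"
    using \<M>(2) by (auto simp: \<N>_def)
  then obtain v where v: "\<And>B N. N \<in> \<M> B \<Longrightarrow> v B N \<in> \<U> \<and> N \<times> B \<subseteq> v B N"
    by metis
  define \<V> where "\<V> = (\<Union>B\<in>\<B>. v B ` \<M> B)"
  have "countable \<V>" "\<V> \<subseteq> \<U>"
    using \<B>(1) \<M>(1) v by (auto simp: \<V>_def)
  moreover have "\<Union>\<U> \<subseteq> \<Union>\<V>"
  proof
    fix p assume "p \<in> \<Union>\<U>"
    then obtain V x s where V: "V \<in> \<U>" "(x, s) \<in> V" and p: "p = (x, s)" by (metis UnionE surj_pair)
    then obtain N C where NC: "openin X N" "open C" "x \<in> N" "s \<in> C" "N \<times> C \<subseteq> V"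
      using \<U> by (force simp: openin_prod_topology_alt)
    then obtain B where B: "B \<in> \<B>" "s \<in> B" "B \<subseteq> C"
      using \<B>(2) by (metis topological_basisE)
    then have "N \<in> \<N> B" using NC V by (auto simp: \<N>_def)
    then have "x \<in> \<Union>(\<M> B)" using \<M>(3) NC(3) by auto
    then show "p \<in> \<Union>\<V>" using v B p unfolding \<V>_def by blast
  qed
  ultimately show "\<exists>\<V>. countable \<V> \<and> \<V> \<subseteq> \<U> \<and> \<Union>\<V> = \<Union>\<U>" by blast
qed

lemma Menger_space_continuous_image:
  assumes f: "continuous_map X Y f" "f ` topspace X = topspace Y" and X: "Menger_space X"
  shows "Menger_space Y"
  unfolding Menger_space_def
proof (intro allI impI)
  fix \<C> :: "nat \<Rightarrow> 'b set set" assume \<C>: "\<forall>n. open_cover Y (\<C> n)"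
  define g where "g V = {x \<in> topspace X. f x \<in> V}" for V
  have "open_cover X (g ` \<C> n)" for n
  proof -
    have "openin X (g V)" if "V \<in> \<C> n" for V
      using \<C> that openin_continuous_map_preimage[OF f(1)] by (auto simp: open_cover_def g_def)
    moreover have "\<Union>(g ` \<C> n) = topspace X"
    proof -
      have "\<Union>(\<C> n) = topspace Y" using \<C> by (simp add: open_cover_def)
      moreover have "f x \<in> topspace Y" if "x \<in> topspace X" for x using f(2) that by blast
      ultimately show ?thesis by (fastforce simp: g_def)
    qed
    ultimately show ?thesis by (auto simp: open_cover_def)
  qed
  then have "\<exists>\<F>. (\<forall>n. finite (\<F> n) \<and> \<F> n \<subseteq> g ` \<C> n) \<and> (\<forall>x\<in>topspace X. \<exists>n. x \<in> \<Union>(\<F> n))"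
    using X[unfolded Menger_space_def, THEN spec, of "\<lambda>n. g ` \<C> n"] by blast
  then obtain \<F> where \<F>1: "\<forall>n. finite (\<F> n) \<and> \<F> n \<subseteq> g ` \<C> n"
    and \<F>2: "\<forall>x\<in>topspace X. \<exists>n. x \<in> \<Union>(\<F> n)"
    by blast
  have "\<forall>n. \<exists>\<G>\<subseteq>\<C> n. finite \<G> \<and> \<F> n = g ` \<G>"
    using \<F>1 by (intro allI finite_subset_image) auto
  from choice[OF this] obtain \<G>
    where \<G>: "\<forall>n. \<G> n \<subseteq> \<C> n \<and> finite (\<G> n) \<and> \<F> n = g ` \<G> n" ..
  have "\<exists>n. y \<in> \<Union>(\<G> n)" if y: "y \<in> topspace Y" for y
  proof -
    obtain x where x: "x \<in> topspace X" "y = f x" using f(2) y by blast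
    obtain n where "x \<in> \<Union>(\<F> n)" using bspec[OF \<F>2 x(1)] ..
    then have "x \<in> \<Union>(g ` \<G> n)" using \<G> by metis
    then show ?thesis using x(2) by (auto simp: g_def)
  qed
  then show "\<exists>\<F>. (\<forall>n. finite (\<F> n) \<and> \<F> n \<subseteq> \<C> n) \<and> (\<forall>x\<in>topspace Y. \<exists>n. x \<in> \<Union>(\<F> n))"
    using \<G> by (intro exI[of _ \<G>]) auto
qed

lemma Menger_imp_Lindelof_space:
  assumes "Menger_space X" shows "Lindelof_space X"
  unfolding Lindelof_space_def
proof (intro allI impI)
  fix \<U> assume \<U>: "(\<forall>U\<in>\<U>. openin X U) \<and> \<Union>\<U> = topspace X"
  then have "\<exists>\<F>::nat \<Rightarrow> _. (\<forall>n. finite (\<F> n) \<and> \<F> n \<subseteq> \<U>) \<and> (\<forall>x\<in>topspace X. \<exists>n. x \<in> \<Union>(\<F> n))"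
    using assms[unfolded Menger_space_def, THEN spec, of "\<lambda>_. \<U>"] by (simp add: open_cover_def)
  then obtain \<F> where \<F>: "\<And>n::nat. finite (\<F> n)" "\<And>n. \<F> n \<subseteq> \<U>"
      "\<And>x. x \<in> topspace X \<Longrightarrow> \<exists>n. x \<in> \<Union>(\<F> n)"
    by blast
  then have "countable (\<Union>n. \<F> n)" "(\<Union>n. \<F> n) \<subseteq> \<U>"
    by (auto intro: countable_finite)
  moreover have "\<Union>(\<Union>n. \<F> n) = topspace X"
    using \<F> \<U> by (intro equalityI subsetI) (blast, fastforce)
  ultimately show "\<exists>\<V>. countable \<V> \<and> \<V> \<subseteq> \<U> \<and> \<Union>\<V> = topspace X" by blast
qed

text \<open>The Menger property is applied to every tail of the sequence; the selections for the
  tails starting at \<open>k \<le> n\<close> are merged at index \<open>n\<close>, which keeps them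
  finite.\<close>

lemma Menger_space_infinitely_often:
  assumes "Menger_space X" "\<And>n. open_cover X (\<C> n)"
  obtains \<F> where "\<And>n::nat. finite (\<F> n) \<and> \<F> n \<subseteq> \<C> n"
    "\<And>x k. x \<in> topspace X \<Longrightarrow> \<exists>n\<ge>k. x \<in> \<Union>(\<F> n)"
proof -
  have "\<forall>k. \<exists>\<F>. (\<forall>n. finite (\<F> n) \<and> \<F> n \<subseteq> \<C> (n + k)) \<and> (\<forall>x\<in>topspace X. \<exists>n. x \<in> \<Union>(\<F> n))"
    using assms unfolding Menger_space_def by simp
  then obtain \<G> where \<G>: "\<And>k n. finite (\<G> k n) \<and> \<G> k n \<subseteq> \<C> (n + k)"
      "\<And>k x. x \<in> topspace X \<Longrightarrow> \<exists>n. x \<in> \<Union>(\<G> k n)"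
    by metis
  define \<F> where "\<F> n = (\<Union>k\<le>n. \<G> k (n - k))" for n
  show thesis
  proof
    show "finite (\<F> n) \<and> \<F> n \<subseteq> \<C> n" for n
      using \<G>(1)[of _ "n - _"] by (fastforce simp: \<F>_def)
    show "\<exists>n\<ge>k. x \<in> \<Union>(\<F> n)" if x: "x \<in> topspace X" for x k
    proof -
      obtain n where "x \<in> \<Union>(\<G> k n)" using \<G>(2) x by blast
      moreover have "\<G> k n \<subseteq> \<F> (n + k)"
        using UN_upper[of k "{..n + k}" "\<lambda>i. \<G> i (n + k - i)"] by (simp add: \<F>_def)
      ultimately have "x \<in> \<Union>(\<F> (n + k))" by blast
      then show ?thesis by (metis le_add2)
    qed
  qed
qed

lemma U_Menger_imp_Menger_space:
  assumes "U_Menger_space U X" "U \<noteq> bot" shows "Menger_space X"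
  unfolding Menger_space_def
  using assms unfolding U_Menger_space_def by (metis (no_types, lifting) eventually_happens)

section \<open>The cardinality bound of de Groot\<close>

text \<open>At the first index \<open>n\<close> where two sets differ, the set containing
  \<open>n\<close> gains \<open>(1/3)^n\<close>, whereas all later terms together amount to at most
  half of that.\<close>

lemma inj_nat_set_real: "inj (\<lambda>S. \<Sum>n. if n \<in> S then (1/3)^n else (0::real))"
proof -
  let ?a = "\<lambda>S n. if n \<in> S then (1/3)^n else (0::real)"
  have sm: "summable (?a S)" for S
    by (rule summable_comparison_test'[of "\<lambda>n. (1/3::real)^n" 0]) (auto intro: summable_geometric)
  have less: "suminf (?a T) < suminf (?a S)"
    if n: "n \<in> S" "n \<notin> T" and eq: "\<And>i. i < n \<Longrightarrow> i \<in> S \<longleftrightarrow> i \<in> T" for S T n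
  proof -
    have "suminf (?a T) = (\<Sum>i. ?a T (i + Suc n)) + (\<Sum>i<Suc n. ?a T i)"
      by (rule suminf_split_initial_segment[OF sm])
    also have "(\<Sum>i. ?a T (i + Suc n)) \<le> (\<Sum>i. (1/3)^(i + Suc n))"
      by (intro suminf_le summable_ignore_initial_segment[OF sm]
          summable_ignore_initial_segment[of "\<lambda>n. (1/3::real)^n"] summable_geometric) auto
    also have "(\<Sum>i. (1/3::real)^(i + Suc n)) = (1/3)^Suc n * (\<Sum>i. (1/3)^i)"
      by (subst suminf_mult[symmetric]) (auto simp: power_add mult_ac intro!: summable_geometric)
    also have "\<dots> = (1/3)^n / 2"
      by (subst suminf_geometric) (auto simp: field_simps)
    also have "\<dots> < (1/3)^n" by simp
    also have "(\<Sum>i<Suc n. ?a T i) = (\<Sum>i<n. ?a T i)" using n by simp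
    also have "(\<Sum>i<n. ?a T i) = (\<Sum>i<n. ?a S i)" using eq by (intro sum.cong) auto
    also have "(1/3)^n + (\<Sum>i<n. ?a S i) = (\<Sum>i<Suc n. ?a S i)" using n by simp
    also have "\<dots> \<le> suminf (?a S)" by (intro sum_le_suminf sm) auto
    finally show ?thesis by simp
  qed
  show ?thesis
  proof (rule injI, rule ccontr)
    fix S T :: "nat set" assume e: "suminf (?a S) = suminf (?a T)" and ne: "S \<noteq> T"
    define n where "n = (LEAST i. (i \<in> S) \<noteq> (i \<in> T))"
    have "\<exists>i. (i \<in> S) \<noteq> (i \<in> T)" using ne by blast
    then have "(n \<in> S) \<noteq> (n \<in> T)" unfolding n_def by (rule LeastI_ex)
    moreover have "i \<in> S \<longleftrightarrow> i \<in> T" if "i < n" for i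
      using not_less_Least that unfolding n_def by blast
    ultimately show False using less[of n S T] less[of n T S] e by force
  qed
qed

text \<open>Fix at every point a countable family of open neighbourhoods with intersection that point.  If
  \<open>y \<notin> A\<close>, neighbourhoods missing \<open>y\<close> cover \<open>A\<close>, and by the hereditary Lindelof property countably
  many of them do.  Hence, from one point, the operation that picks a point outside a countable union
  of such neighbourhoods generates the whole space, which is thus an image of the set of countably
  branching trees.\<close>

datatype ctree = Leaf | Node "nat \<Rightarrow> ctree" "nat \<Rightarrow> nat"

text \<open>There are only countably many finite paths, so these codes number at most the continuum.
  The value at \<open>[]\<close> separates \<open>Leaf\<close> from \<open>Node\<close>, and pairing
  keeps both the label and the code of each subtree recoverable.\<close>

primrec ctree_code :: "ctree \<Rightarrow> nat list \<Rightarrow> nat" where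
  "ctree_code Leaf = (\<lambda>_. 0)"
| "ctree_code (Node t k) =
     (\<lambda>p. case p of [] \<Rightarrow> 1 | i # q \<Rightarrow> prod_encode (k i, ctree_code (t i) q))"

lemma inj_ctree_code: "inj ctree_code"
proof (rule injI)
  show "s = t" if "ctree_code s = ctree_code t" for s t
    using that
  proof (induction s arbitrary: t)
    case Leaf
    then show ?case by (cases t) (auto dest: fun_cong[of _ _ "[]"])
  next
    case (Node f k)
    show ?case
    proof (cases t)
      case Leaf
      then show ?thesis using Node.prems by (auto dest: fun_cong[of _ _ "[]"])
    next
      case (Node g l)
      have "prod_encode (k i, ctree_code (f i) q) = prod_encode (l i, ctree_code (g i) q)" for i q
        using fun_cong[OF Node.prems, of "i # q"] Node by simp
      then have "k i = l i" "ctree_code (f i) = ctree_code (g i)" for i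
        by (auto simp: prod_encode_eq)
      then show ?thesis using Node.IH Node by (metis ext rangeI)
    qed
  qed
qed

lemma card_of_ctree_le_real: "|UNIV :: ctree set| \<le>o |UNIV :: real set|"
proof -
  \<comment> \<open>The graph of \<open>ctree_code t\<close> consists of elements of a countable
    type, so it becomes a set of natural numbers.\<close>
  define G where "G t = to_nat ` {(p, ctree_code t p) | p. True}" for t
  have "inj G"
  proof (rule injI)
    fix s t assume "G s = G t"
    then have "{(p, ctree_code s p) | p. True} = {(p, ctree_code t p) | p. True}"
      unfolding G_def by (simp add: inj_image_eq_iff)
    then have "ctree_code s = ctree_code t" by (auto simp: set_eq_iff fun_eq_iff)
    then show "s = t" using inj_ctree_code by (simp add: inj_eq)
  qed
  then have "inj ((\<lambda>S. \<Sum>n. if n \<in> S then (1/3)^n else (0::real)) \<circ> G)"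
    using inj_nat_set_real by (rule inj_compose[rotated])
  then show ?thesis by (meson card_of_ordLeq top_greatest)
qed

text \<open>Every other point has an open \<open>V\<close> disjoint from some neighbourhood of
  \<open>y\<close>. Countably many such \<open>V\<close> cover all other points, and the matching
  neighbourhoods of \<open>y\<close> have only \<open>y\<close> in common.\<close>

lemma Hausdorff_hereditarily_Lindelof_pseudobase:
  assumes "Hausdorff_space Y" "hereditarily_Lindelof_space Y" "y \<in> topspace Y"
  shows "\<exists>B::nat \<Rightarrow> _. (\<forall>n. openin Y (B n) \<and> y \<in> B n) \<and> (\<forall>x\<in>topspace Y. x \<noteq> y \<longrightarrow> (\<exists>n. x \<notin> B n))"
proof -
  define \<U> where "\<U> = {V. openin Y V \<and> (\<exists>W. openin Y W \<and> y \<in> W \<and> W \<inter> V = {})}"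
  obtain \<V> where \<V>: "countable \<V>" "\<V> \<subseteq> \<U>" "\<Union>\<V> = \<Union>\<U>"
    using assms(2) unfolding hereditarily_Lindelof_space_alt \<U>_def
    by (metis (no_types, lifting) mem_Collect_eq)
  have "\<forall>V\<in>\<V>. \<exists>W. openin Y W \<and> y \<in> W \<and> W \<inter> V = {}"
    using \<V>(2) by (auto simp: \<U>_def)
  then obtain w where w: "\<And>V. V \<in> \<V> \<Longrightarrow> openin Y (w V) \<and> y \<in> w V \<and> w V \<inter> V = {}"
    by metis
  \<comment> \<open>Adding \<open>topspace Y\<close> keeps the family nonempty, as its enumeration
    requires, even if \<open>\<V>\<close> is empty.\<close>
  define \<W> where "\<W> = insert (topspace Y) (w ` \<V>)"
  have \<W>: "countable \<W>" "\<W> \<noteq> {}" using \<V>(1) by (auto simp: \<W>_def)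
  have "\<exists>n. x \<notin> from_nat_into \<W> n" if x: "x \<in> topspace Y" "x \<noteq> y" for x
  proof -
    obtain V W where "openin Y V" "x \<in> V" "openin Y W" "y \<in> W" "W \<inter> V = {}"
      using assms(1,3) x unfolding Hausdorff_space_def disjnt_def by (metis inf_commute)
    then have "x \<in> \<Union>\<V>" using \<V>(3) unfolding \<U>_def by blast
    then obtain V' where "V' \<in> \<V>" "x \<in> V'" by blast
    then have "x \<notin> w V'" "w V' \<in> \<W>" using w by (auto simp: \<W>_def)
    then show ?thesis using \<W> by (metis from_nat_into_surj)
  qed
  moreover have "openin Y (from_nat_into \<W> n) \<and> y \<in> from_nat_into \<W> n" for n
    using from_nat_into[OF \<W>(2), of n] w assms(3) by (auto simp: \<W>_def)
  ultimately show ?thesis by blast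
qed

theorem card_of_Hausdorff_hereditarily_Lindelof_le_real:
  assumes "Hausdorff_space Y" "hereditarily_Lindelof_space Y"
  shows "|topspace Y| \<le>o |UNIV :: real set|"
proof (cases "topspace Y = {}")
  case True
  then show ?thesis by (simp add: card_of_empty)
next
  case False
  then obtain y0 where y0: "y0 \<in> topspace Y" by blast
  obtain B where B: "\<And>y n::nat. y \<in> topspace Y \<Longrightarrow> openin Y (B y n) \<and> y \<in> B y n"
      "\<And>y x. y \<in> topspace Y \<Longrightarrow> x \<in> topspace Y \<Longrightarrow> x \<noteq> y \<Longrightarrow> \<exists>n. x \<notin> B y n"
    using Hausdorff_hereditarily_Lindelof_pseudobase[OF assms] by metis
  \<comment> \<open>When \<open>V\<close> contains the whole space, \<open>pt V\<close> is an
    arbitrary point, so that \<open>val\<close> always stays in the space.\<close>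
  define pt where "pt V = (SOME z. z \<in> topspace Y \<and> (V \<inter> topspace Y \<noteq> topspace Y \<longrightarrow> z \<notin> V))" for V
  have pt: "pt V \<in> topspace Y \<and> (V \<inter> topspace Y \<noteq> topspace Y \<longrightarrow> pt V \<notin> V)" for V
    unfolding pt_def by (rule someI_ex) (use y0 in blast)
  \<comment> \<open>The recursor hands over pairs of a subtree and its value; \<open>snd\<close>
    selects the value.\<close>
  define val where "val = rec_ctree y0 (\<lambda>t k. pt (\<Union>i. B (snd (t i)) (k i)))"
  have val: "val Leaf = y0" "val (Node t k) = pt (\<Union>i. B (val (t i)) (k i))" for t k
    by (simp_all add: val_def comp_def)
  have val_in: "val t \<in> topspace Y" for t
    by (cases t) (use pt y0 in \<open>simp_all add: val\<close>)
  have "topspace Y \<subseteq> range val"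
  proof
    fix y assume y: "y \<in> topspace Y"
    show "y \<in> range val"
    proof (rule ccontr)
      \<comment> \<open>If \<open>y\<close> is never a value, each value has a listed neighbourhood
        missing \<open>y\<close>. Countably many of these contain all values, yet the node built
        from them has a value outside their union.\<close>
      assume ny: "y \<notin> range val"
      then have "\<forall>t. \<exists>n. y \<notin> B (val t) n"
        using B(2)[OF val_in y] by (metis rangeI)
      then obtain k where k: "\<And>t. y \<notin> B (val t) (k t)" by metis
      obtain T where T: "countable T" "(\<Union>t\<in>T. B (val t) (k t)) = (\<Union>t. B (val t) (k t))"
        using hereditarily_Lindelof_space_UN[OF assms(2), of UNIV "\<lambda>t. B (val t) (k t)"] B(1)[OF val_in]
        by (metis UNIV_I)
      have "T \<noteq> {}" using T(2) B(1)[OF val_in] by blast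
      define t where "t = from_nat_into T"
      have rt: "range t = T" using T \<open>T \<noteq> {}\<close> by (simp add: t_def range_from_nat_into)
      define V where "V = (\<Union>i. B (val (t i)) (k (t i)))"
      have V: "V = (\<Union>t. B (val t) (k t))"
        unfolding V_def T(2)[symmetric] rt[symmetric] by (simp add: image_image)
      have "y \<notin> V" using k by (simp add: V_def)
      then have "pt V \<notin> V" using pt y by blast
      moreover have "pt V = val (Node t (\<lambda>i. k (t i)))" by (simp add: val V_def)
      ultimately show False using B(1)[OF val_in] V by (metis UN_iff UNIV_I)
    qed
  qed
  then have "|topspace Y| \<le>o |UNIV :: ctree set|"
    by (meson card_of_image card_of_mono1 ordLeq_transitive)
  then show ?thesis using card_of_ctree_le_real ordLeq_transitive by blast
qed

section \<open>Second factors of arbitrary point type\<close>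

text \<open>The topology is carried along an injection \<open>j\<close> by pulling it back under the
  inverse of \<open>j\<close>.\<close>

lemma homeomorphic_copy:
  assumes "|topspace Z| \<le>o |UNIV :: 'b set|"
  obtains Z' :: "'b topology" where "Z homeomorphic_space Z'"
proof -
  obtain j :: "_ \<Rightarrow> 'b" where j: "inj_on j (topspace Z)"
    using assms by (meson card_of_ordLeq)
  define i where "i = inv_into (topspace Z) j"
  define Z' where "Z' = pullback_topology (j ` topspace Z) i Z"
  have ij: "i (j z) = z" if "z \<in> topspace Z" for z
    using j that by (simp add: i_def)
  have top: "topspace Z' = j ` topspace Z"
    unfolding Z'_def topspace_pullback_topology using ij by auto
  have "homeomorphic_maps Z Z' j i"
    unfolding homeomorphic_maps_def
  proof (intro conjI ballI)
    show "continuous_map Z Z' j"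
      unfolding Z'_def
    proof (rule continuous_map_pullback')
      show "continuous_map Z Z (i \<circ> j)"
        by (rule continuous_map_eq[OF continuous_map_id]) (simp add: ij)
      show "topspace Z \<subseteq> j -` (j ` topspace Z)" by blast
    qed
    show "continuous_map Z' Z i"
      unfolding Z'_def using continuous_map_pullback[OF continuous_map_id] by fastforce
  qed (auto simp: ij top)
  then show thesis using that homeomorphic_space_def by blast
qed

lemma hereditarily_Lindelof_space_homeomorphic:
  assumes "X homeomorphic_space Y" "hereditarily_Lindelof_space X"
  shows "hereditarily_Lindelof_space Y"
  unfolding hereditarily_Lindelof_space_alt
proof (intro allI impI)
  fix \<U> assume \<U>: "\<forall>V\<in>\<U>. openin Y V"
  obtain f g where fg: "homeomorphic_maps X Y f g" using assms(1) homeomorphic_space_def by blast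
  define h where "h V = {x \<in> topspace X. f x \<in> V}" for V
  have "openin X (h V)" if "V \<in> \<U>" for V
    using fg \<U> that openin_continuous_map_preimage[of X Y f V] by (simp add: h_def homeomorphic_maps_def)
  then obtain \<W> where \<W>: "countable \<W>" "\<W> \<subseteq> \<U>" "(\<Union>V\<in>\<W>. h V) = (\<Union>V\<in>\<U>. h V)"
    using hereditarily_Lindelof_space_UN[OF assms(2), of \<U> h] by metis
  have "y \<in> \<Union>\<W>" if "V \<in> \<U>" "y \<in> V" for y V
  proof -
    have y: "y \<in> topspace Y" using that \<U> openin_subset by blast
    then have gy: "g y \<in> topspace X" "f (g y) = y"
      using fg unfolding homeomorphic_maps_def by (auto simp: continuous_map_def)
    then have "g y \<in> (\<Union>V\<in>\<U>. h V)" using that by (auto simp: h_def)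
    then have "g y \<in> (\<Union>V\<in>\<W>. h V)" by (simp only: \<W>(3))
    then show ?thesis using gy by (auto simp: h_def)
  qed
  then have "\<Union>\<W> = \<Union>\<U>" using \<W>(2) by blast
  then show "\<exists>\<V>. countable \<V> \<and> \<V> \<subseteq> \<U> \<and> \<Union>\<V> = \<Union>\<U>" using \<W> by blast
qed

text \<open>The hypothesis speaks only of second factors with points in \<open>real\<close>. By the
  cardinality bound \<open>Z\<close> has a homeomorphic copy there, and the Menger property returns
  to \<open>X \<times> Z\<close> along a map that is the identity on \<open>X\<close>.\<close>

lemma productively_Menger_in_hLD:
  fixes Z :: "'c topology"
  assumes X: "productively_Menger_in_hL TYPE(real) X"
    and Z: "infinite_Tychonoff_space Z" "hereditarily_Lindelof_space Z" "Menger_space Z"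
  shows "Menger_space (prod_topology X Z)"
proof -
  have "Hausdorff_space Z" using Z(1) by (simp add: infinite_Tychonoff_space_def)
  then obtain Z' :: "real topology" where hom: "Z homeomorphic_space Z'"
    using homeomorphic_copy[OF card_of_Hausdorff_hereditarily_Lindelof_le_real] Z(2) by blast
  then obtain f g where fg: "homeomorphic_maps Z Z' f g" using homeomorphic_space_def by blast
  then have f: "continuous_map Z Z' f" "f ` topspace Z = topspace Z'"
    and g: "continuous_map Z' Z g" "g ` topspace Z' = topspace Z"
    by (metis homeomorphic_imp_continuous_map homeomorphic_maps_map,
        metis homeomorphic_imp_surjective_map homeomorphic_maps_map,
        metis homeomorphic_imp_continuous_map homeomorphic_maps_map,
        metis homeomorphic_imp_surjective_map homeomorphic_maps_map)
  have "infinite_Tychonoff_space Z'"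
    using Z(1) hom f(2) g(2) homeomorphic_completely_regular_space homeomorphic_Hausdorff_space
    unfolding infinite_Tychonoff_space_def by (metis finite_imageI)
  moreover have "hereditarily_Lindelof_space Z'"
    using hereditarily_Lindelof_space_homeomorphic[OF hom Z(2)] .
  moreover have "Menger_space Z'"
    using Menger_space_continuous_image[OF f Z(3)] .
  ultimately have "Menger_space (prod_topology X Z')"
    using X unfolding productively_Menger_in_hL_def by blast
  moreover have "continuous_map (prod_topology X Z') (prod_topology X Z) (\<lambda>(x, z). (x, g z))"
    unfolding continuous_map_prod_top using g(1) by (simp add: continuous_map_id[unfolded id_def])
  moreover have "(\<lambda>(x, z). (x, g z)) ` topspace (prod_topology X Z') = topspace (prod_topology X Z)"
    unfolding topspace_prod_topology g(2)[symmetric] by force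
  ultimately show ?thesis using Menger_space_continuous_image by blast
qed

section \<open>Functions bounded modulo an ultrafilter\<close>

lemma le_enumerate_range:
  fixes s :: "nat \<Rightarrow> nat"
  assumes "strict_mono s"
  shows "s n \<le> enumerate (range s) n"
proof (induction n)
  have inf: "infinite (range s)"
    using assms by (simp add: finite_image_iff strict_mono_imp_inj_on)
  {
    case 0
    obtain k where "enumerate (range s) 0 = s k" using enumerate_in_set[OF inf, of 0] by auto
    then show ?case using assms by (simp add: strict_mono_less_eq)
  next
    case (Suc n)
    obtain k where k: "enumerate (range s) (Suc n) = s k"
      using enumerate_in_set[OF inf, of "Suc n"] by blast
    have "s n < s k" using Suc enumerate_step[OF inf, of n] k by simp
    then have "Suc n \<le> k" using assms by (simp add: strict_mono_less)
    then show ?case using assms k by (simp add: strict_mono_less_eq)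
  }
qed

text \<open>\<open>b_U\<close> concerns sets through their enumerations. A function \<open>f\<close>
  lies below the strictly increasing partial sums \<open>s f\<close>, whose range is an infinite
  set, so a bound for these ranges bounds \<open>B\<close>.\<close>

lemma card_less_b_U_imp_bounded:
  fixes B :: "(nat \<Rightarrow> nat) set"
  assumes U: "free_ultrafilter U" and B: "|B| <o b_U U"
  shows "\<exists>h. \<forall>f\<in>B. \<forall>\<^sub>F n in U. f n \<le> h n"
proof -
  define s where "s f n = (\<Sum>i\<le>n. Suc (f i))" for f :: "nat \<Rightarrow> nat" and n
  have s: "strict_mono (s f)" for f
    by (rule strict_mono_Suc_iff[THEN iffD2]) (simp add: s_def)
  define A where "A = (\<lambda>f. range (s f)) ` B"
  have inf: "infinite a" if "a \<in> A" for a
    using that s unfolding A_def by (auto simp: finite_image_iff strict_mono_imp_inj_on)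
  have "|A| <o b_U U"
    using ordLeq_ordLess_trans[OF card_of_image B] by (simp add: A_def)
  moreover have "\<forall>B. U_unbounded U B \<longrightarrow> b_U U \<le>o |B|"
    using min_card[where P = "U_unbounded U", OF U_unbounded_all_infinite[OF U]] by (metis b_U_def)
  ultimately have "\<not> U_unbounded U A" using not_ordLess_ordLeq by blast
  then obtain b where b: "\<And>a. a \<in> A \<Longrightarrow> le_U U a b"
    using inf unfolding U_unbounded_def U_bounded_def by blast
  have "\<forall>\<^sub>F n in U. f n \<le> enumerate b n" if "f \<in> B" for f
  proof -
    have "\<forall>\<^sub>F n in U. enumerate (range (s f)) n \<le> enumerate b n"
      using b[of "range (s f)"] that by (simp add: A_def le_U_def)
    then show ?thesis
    proof (rule eventually_mono)
      fix n assume "enumerate (range (s f)) n \<le> enumerate b n"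
      moreover have "f n \<le> s f n"
        unfolding s_def by (rule order_trans[OF _ member_le_sum[of n]]) auto
      ultimately show "f n \<le> enumerate b n" using le_enumerate_range[OF s, of f n] by linarith
    qed
  qed
  then show ?thesis by blast
qed

text \<open>Too few functions cannot be dominating. A single index \<open>n\<close> per function is
  all that a Menger selection needs to catch a point.\<close>

lemma card_less_dominating_number:
  fixes K :: "(nat \<Rightarrow> nat) set"
  assumes "|K| <o dominating_number"
  obtains g where "\<And>k. k \<in> K \<Longrightarrow> \<exists>n. k n < g n"
proof -
  have "\<forall>B. dominating B \<longrightarrow> dominating_number \<le>o |B|"
    using min_card[where P = dominating, OF dominating_UNIV] by (metis dominating_number_def)
  then have "\<not> dominating K" using assms not_ordLess_ordLeq by blast
  then obtain g where g: "\<And>k. k \<in> K \<Longrightarrow> \<not> (\<forall>\<^sub>F n in sequentially. g n \<le> k n)"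
    unfolding dominating_def by blast
  have "\<exists>n. k n < g n" if k: "k \<in> K" for k
  proof (rule ccontr)
    assume "\<nexists>n. k n < g n"
    then have "\<forall>\<^sub>F n in sequentially. g n \<le> k n" by (simp add: not_less)
    then show False using g[OF k] by blast
  qed
  then show thesis by (rule that)
qed

section \<open>Enumerated covers and intervals in coded sets\<close>

lemma Lindelof_space_sequence_covers:
  fixes \<C> :: "nat \<Rightarrow> 'a set set"
  assumes "Lindelof_space X" "topspace X \<noteq> {}" "\<forall>n. open_cover X (\<C> n)"
  shows "\<exists>c :: nat \<Rightarrow> nat \<Rightarrow> 'a set. \<forall>n. range (c n) \<subseteq> \<C> n \<and> \<Union>(range (c n)) = topspace X"
proof (intro choice allI)
  fix n
  have "\<exists>\<W>. countable \<W> \<and> \<W> \<subseteq> \<C> n \<and> \<Union>\<W> = topspace X"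
    using assms(3) by (intro Lindelof_spaceD[OF assms(1)]) (auto simp: open_cover_def)
  then obtain \<W> where \<W>: "countable \<W>" "\<W> \<subseteq> \<C> n" "\<Union>\<W> = topspace X" by metis
  have "\<W> \<noteq> {}" using \<W>(3) assms(2) by blast
  then have "range (from_nat_into \<W>) = \<W>" using \<W>(1) by (rule range_from_nat_into)
  then show "\<exists>c::nat \<Rightarrow> 'a set. range c \<subseteq> \<C> n \<and> \<Union>(range c) = topspace X"
    using \<W>(2,3) by metis
qed

text \<open>A basic open box around \<open>s\<close> restricts only finitely many coordinates;
  \<open>k\<close> lies beyond them.\<close>

lemma open_fun_cylinder:
  fixes W :: "(nat \<Rightarrow> 'a::topological_space) set"
  assumes "open W" "s \<in> W"
  shows "\<exists>k. \<forall>s'. (\<forall>i<k. s' i = s i) \<longrightarrow> s' \<in> W"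
proof -
  have "openin (product_topology (\<lambda>i. euclidean) UNIV) W" using assms(1) by (simp add: open_fun_def)
  from product_topology_open_contains_basis[OF this assms(2)]
  obtain V where V: "s \<in> (\<Pi>\<^sub>E i\<in>UNIV. V i)" "finite {i. V i \<noteq> UNIV}" "(\<Pi>\<^sub>E i\<in>UNIV. V i) \<subseteq> W"
    by auto
  obtain k where k: "\<forall>i\<in>{i. V i \<noteq> UNIV}. i < k"
    using V(2) unfolding finite_nat_set_iff_bounded by (rule exE)
  have "s' \<in> W" if "\<forall>i<k. s' i = s i" for s'
  proof -
    have "s' i \<in> V i" for i
    proof (cases "i < k")
      case True
      then show ?thesis using that V(1) by (simp add: PiE_iff)
    next
      case False
      then have "V i = UNIV" using k by blast
      then show ?thesis by simp
    qed
    then show ?thesis using V(3) by (auto simp: PiE_iff)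
  qed
  then show ?thesis by blast
qed

text \<open>Fix \<open>y\<close> and \<open>n\<close>. A set containing \<open>{n..<k}\<close>
  agrees below \<open>k\<close> with the complement of some \<open>F \<subseteq> {..<n}\<close>.
  There are finitely many such \<open>F\<close>, so for large \<open>k\<close> finitely many members
  of \<open>\<V> n\<close> take care of all these sets near \<open>y\<close>. The
  \<open>U\<close>-Menger property of \<open>Y\<close> then selects finitely many of the resulting
  neighbourhoods for each \<open>n\<close>.\<close>

lemma U_Menger_space_interval_cover:
  fixes Y :: "'b topology" and \<V> :: "nat \<Rightarrow> ('b \<times> (nat \<Rightarrow> real)) set set"
  assumes Y: "U_Menger_space U Y"
    and op: "\<And>n V. V \<in> \<V> n \<Longrightarrow> openin (prod_topology Y euclidean) V"
    and cov: "\<And>n y F. y \<in> topspace Y \<Longrightarrow> finite F \<Longrightarrow> \<exists>V\<in>\<V> n. (y, indicator (- F)) \<in> V"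
  shows "\<exists>\<F> h. (\<forall>n. finite (\<F> n) \<and> \<F> n \<subseteq> \<V> n) \<and>
    (\<forall>y\<in>topspace Y. \<forall>\<^sub>F n in U. \<forall>S. {n..<h n} \<subseteq> S \<longrightarrow> (y, indicator S) \<in> \<Union>(\<F> n))"
proof -
  define good where "good n N \<G> k \<longleftrightarrow> finite \<G> \<and> \<G> \<subseteq> \<V> n \<and>
      (\<forall>y\<in>N. \<forall>S. {n..<k} \<subseteq> S \<longrightarrow> (y, indicator S) \<in> \<Union>\<G>)" for n N \<G> and k :: nat
  define \<N> where "\<N> n = {N. openin Y N \<and> (\<exists>\<G> k. good n N \<G> k)}" for n
  have "open_cover Y (\<N> n)" for n
  proof -
    have "\<exists>N\<in>\<N> n. y \<in> N" if y: "y \<in> topspace Y" for y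
    proof -
      have "\<exists>V N k. V \<in> \<V> n \<and> openin Y N \<and> y \<in> N \<and>
          (\<forall>y'\<in>N. \<forall>s'. (\<forall>i<k. s' i = indicator (- F) i) \<longrightarrow> (y', s') \<in> V)"
        if F: "F \<subseteq> {..<n}" for F
      proof -
        have "finite F" using F finite_subset by blast
        then obtain V where V: "V \<in> \<V> n" "(y, indicator (- F)) \<in> V" using cov[OF y] by blast
        then obtain N C where NC: "openin Y N" "open C" "y \<in> N" "indicator (- F) \<in> C" "N \<times> C \<subseteq> V"
          using op[OF V(1)] unfolding openin_prod_topology_alt by (metis open_openin)
        then obtain k where "\<forall>s'. (\<forall>i<k. s' i = indicator (- F) i) \<longrightarrow> s' \<in> C"
          using open_fun_cylinder by blast
        then show ?thesis using V NC by blast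
      qed
      then obtain V N k where VNk: "\<And>F. F \<subseteq> {..<n} \<Longrightarrow> V F \<in> \<V> n \<and> openin Y (N F) \<and> y \<in> N F \<and>
          (\<forall>y'\<in>N F. \<forall>s'. (\<forall>i<k F. s' i = indicator (- F) i) \<longrightarrow> (y', s') \<in> V F)"
        by metis
      let ?I = "Pow {..<n}"
      define N' where "N' = (\<Inter>F\<in>?I. N F)"
      \<comment> \<open>The sum serves as a common upper bound of the finitely many
        \<open>k F\<close>; \<open>h\<close> below is formed likewise.\<close>
      define k' where "k' = (\<Sum>F\<in>?I. k F)"
      have k': "k F \<le> k'" if "F \<in> ?I" for F
        unfolding k'_def by (rule member_le_sum[OF that]) auto
      have "openin Y N'" "y \<in> N'"
        unfolding N'_def using VNk by (auto intro!: openin_INT2)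
      moreover have "good n N' (V ` ?I) k'"
        unfolding good_def
      proof (intro conjI ballI allI impI)
        show "V ` ?I \<subseteq> \<V> n" using VNk by auto
        fix y' S assume y': "y' \<in> N'" and S: "{n..<k'} \<subseteq> S"
        \<comment> \<open>\<open>S\<close> has no gaps in \<open>{n..<k'}\<close>, so its gaps below
          \<open>k'\<close> all lie in \<open>F\<close>, and \<open>- F\<close> agrees with
          \<open>S\<close> there.\<close>
        define F where "F = {..<n} - S"
        have F: "F \<subseteq> {..<n}" by (auto simp: F_def)
        have "indicator S i = (indicator (- F) i :: real)" if "i < k F" for i
        proof -
          have "i < k'" using k'[of F] F that by simp
          then have "i \<in> S \<longleftrightarrow> i \<in> - F" using S by (cases "i < n") (auto simp: F_def)
          then show ?thesis by (simp add: indicator_def)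
        qed
        moreover have "y' \<in> N F" using y' F by (auto simp: N'_def)
        ultimately have "(y', indicator S) \<in> V F" using VNk[OF F] by blast
        then show "(y', indicator S) \<in> \<Union>(V ` ?I)" using F by blast
      qed simp
      ultimately show ?thesis unfolding \<N>_def by blast
    qed
    then show ?thesis
      unfolding open_cover_def \<N>_def using openin_subset by fastforce
  qed
  then have "\<exists>\<H>. (\<forall>n. finite (\<H> n) \<and> \<H> n \<subseteq> \<N> n) \<and> (\<forall>y\<in>topspace Y. \<forall>\<^sub>F n in U. y \<in> \<Union>(\<H> n))"
    using Y[unfolded U_Menger_space_def, THEN spec, of \<N>] by blast
  then obtain \<H> where \<H>: "\<forall>n. finite (\<H> n) \<and> \<H> n \<subseteq> \<N> n"
    and \<H>U: "\<forall>y\<in>topspace Y. \<forall>\<^sub>F n in U. y \<in> \<Union>(\<H> n)" by blast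
  have "\<forall>n. \<forall>N\<in>\<H> n. \<exists>\<G> k. good n N \<G> k" using \<H> unfolding \<N>_def by blast
  then obtain \<G> k where \<G>: "\<And>n N. N \<in> \<H> n \<Longrightarrow> good n N (\<G> n N) (k n N)" by metis
  define \<F> where "\<F> n = (\<Union>N\<in>\<H> n. \<G> n N)" for n
  define h where "h n = (\<Sum>N\<in>\<H> n. k n N)" for n
  show ?thesis
  proof (intro exI[of _ \<F>] exI[of _ h] conjI allI ballI)
    show "finite (\<F> n)" "\<F> n \<subseteq> \<V> n" for n
      using \<H> \<G> unfolding \<F>_def good_def by blast+
    fix y assume "y \<in> topspace Y"
    then have "\<forall>\<^sub>F n in U. y \<in> \<Union>(\<H> n)" using \<H>U by blast
    then show "\<forall>\<^sub>F n in U. \<forall>S. {n..<h n} \<subseteq> S \<longrightarrow> (y, indicator S) \<in> \<Union>(\<F> n)"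
    proof (rule eventually_mono, intro allI impI)
      fix n S assume "y \<in> \<Union>(\<H> n)" and S: "{n..<h n} \<subseteq> S"
      then obtain N where N: "N \<in> \<H> n" "y \<in> N" by blast
      have "k n N \<le> h n" unfolding h_def by (rule member_le_sum[OF N(1)]) (use \<H> in auto)
      then have "{n..<k n N} \<subseteq> S" using S by auto
      then have "(y, indicator S) \<in> \<Union>(\<G> n N)" using \<G>[OF N(1)] N(2) unfolding good_def by blast
      then show "(y, indicator S) \<in> \<Union>(\<F> n)" using N(1) by (auto simp: \<F>_def)
    qed
  qed
qed

section \<open>The auxiliary space \<open>Z\<close> and the bound modulo \<open>U\<close>\<close>

text \<open>In the application, \<open>f p n\<close> tells how much of the enumerated covers is
  needed to catch \<open>p\<close>, so that a bound modulo \<open>U\<close> yields a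
  \<open>U\<close>-Menger selection. Monotonicity makes a large value at \<open>n\<close> persist on
  an interval; \<open>open_f\<close> makes the covers of \<open>X \<times> Z\<close> by the sets
  \<open>W n m\<close> open.\<close>

lemma productively_Menger_imp_U_bounded:
  fixes X :: "'a topology" and Y :: "'b topology" and f :: "'a \<times> 'b \<Rightarrow> nat \<Rightarrow> nat"
  assumes X: "productively_Menger_in_hL TYPE(real) X"
    and Y: "infinite_Tychonoff_space Y" "hereditarily_Lindelof_space Y" "U_Menger_space U Y"
    and U: "free_ultrafilter U" "b_U U =o dominating_number"
    and mono_f: "\<And>p. mono (f p)"
    and open_f: "\<And>n m. openin (prod_topology X Y) {p \<in> topspace (prod_topology X Y). f p n \<le> m}"
  shows "\<exists>h. \<forall>p\<in>topspace (prod_topology X Y). \<forall>\<^sub>F n in U. f p n \<le> h n"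
proof (rule ccontr)
  let ?XY = "prod_topology X Y"
  assume "\<not> ?thesis"
  then have not_bdd: "\<exists>p\<in>topspace ?XY. \<not> (\<forall>\<^sub>F n in U. f p n \<le> h n)" for h by blast
  \<comment> \<open>For an ultrafilter, failing to be bounded by \<open>h\<close> means exceeding
    \<open>h\<close> on a set in \<open>U\<close>.\<close>
  have unb: "\<exists>p\<in>topspace ?XY. \<forall>\<^sub>F n in U. h n < f p n" for h
  proof -
    obtain p where p: "p \<in> topspace ?XY" "\<not> (\<forall>\<^sub>F n in U. f p n \<le> h n)" using not_bdd[of h] ..
    have "\<forall>\<^sub>F n in U. \<not> f p n \<le> h n" using U(1) p(2) unfolding free_ultrafilter_def by blast
    then show ?thesis using p(1) by (auto simp: not_le)
  qed
  have Ubot: "U \<noteq> bot" and Ucof: "U \<le> sequentially"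
    using U(1) by (auto simp: free_ultrafilter_def cofinite_eq_sequentially)

  obtain D where D: "dominating D" "dominating_number = |D|"
    using min_card[where P = dominating, OF dominating_UNIV] by (metis dominating_number_def)
  let ?r = "|D|"
  have wo: "Well_order ?r" "Field ?r = D" by (rule card_of_Well_order, rule Field_card_of)
  \<comment> \<open>\<open>|D|\<close> is a well-order of \<open>D\<close> of least type, so its
    proper initial segments are smaller and, by the hypothesis on \<open>b_U U\<close>, bounded
    modulo \<open>U\<close>.\<close>
  have small: "|underS ?r d| <o ?r" if "d \<in> D" for d
    using card_of_underS[OF card_of_Card_order, of d D] that by (simp only: Field_card_of)
  have "\<exists>h. \<forall>d'\<in>underS ?r d. \<forall>\<^sub>F n in U. d' n \<le> h n" if "d \<in> D" for d
    using card_less_b_U_imp_bounded[OF U(1)]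
      ordLess_ordIso_trans[OF small[OF that] ordIso_symmetric[OF U(2)[unfolded D(2)]]] .
  then obtain e0 where e0: "\<And>d d'. d \<in> D \<Longrightarrow> d' \<in> underS ?r d \<Longrightarrow> \<forall>\<^sub>F n in U. d' n \<le> e0 d n"
    by metis
  \<comment> \<open>\<open>Suc n\<close> makes \<open>{n..<e d n}\<close> contain \<open>n\<close>,
    \<open>d n\<close> serves the case \<open>d' = d\<close>, and \<open>e0 d n\<close> handles the
    proper predecessors.\<close>
  define e where "e d n = max (Suc n) (max (d n) (e0 d n))" for d n
  have e: "\<forall>\<^sub>F n in U. d' n \<le> e d n" if "d \<in> D" "(d', d) \<in> ?r" for d d'
  proof (cases "d' = d")
    case True
    then have "d' n \<le> e d n" for n by (simp add: e_def max.coboundedI1 max.coboundedI2)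
    then show ?thesis by (intro always_eventually allI)
  next
    case False
    then have "\<forall>\<^sub>F n in U. d' n \<le> e0 d n" using e0 that by (simp add: underS_def)
    then show ?thesis by (rule eventually_mono) (auto simp: e_def)
  qed

  \<comment> \<open>The sum bounds every \<open>d i\<close> with \<open>i \<le> e d n\<close> at
    once.\<close>
  have "\<forall>d. \<exists>p\<in>topspace ?XY. \<forall>\<^sub>F n in U. (\<Sum>i\<le>e d n. d i) < f p n" by (intro allI unb)
  then obtain p where p: "\<And>d. p d \<in> topspace ?XY"
      "\<And>d. \<forall>\<^sub>F n in U. (\<Sum>i\<le>e d n. d i) < f (p d) n" by metis
  define S where "S d = {i. d i < f (p d) i}" for d
  have S: "\<forall>\<^sub>F n in U. {n..<e d n} \<subseteq> S d" for d
    using p(2)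
  proof (rule eventually_mono)
    fix n assume n: "(\<Sum>i\<le>e d n. d i) < f (p d) n"
    have "i \<in> S d" if "n \<le> i" "i < e d n" for i
    proof -
      have "d i \<le> (\<Sum>i\<le>e d n. d i)" using that by (intro member_le_sum) auto
      moreover have "f (p d) n \<le> f (p d) i" using mono_f[of "p d"] that by (simp add: monoD)
      ultimately show ?thesis using n by (simp add: S_def)
    qed
    then show "{n..<e d n} \<subseteq> S d" by auto
  qed
  have inf_S: "infinite (S d)" for d
  proof
    assume "finite (S d)"
    then have "\<forall>\<^sub>F n in sequentially. n \<notin> S d"
      unfolding cofinite_eq_sequentially[symmetric] by (simp add: eventually_cofinite)
    then have "\<forall>\<^sub>F n in U. n \<notin> S d" using Ucof by (rule filter_leD[rotated])
    moreover have "\<forall>\<^sub>F n in U. n \<in> S d" using S[of d] by (rule eventually_mono) (auto simp: e_def)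
    ultimately have "\<forall>\<^sub>F n in U. False" by eventually_elim blast
    then show False using Ubot by (simp add: trivial_limit_def)
  qed

  \<comment> \<open>Real-valued indicators place the Cantor set in
    \<open>nat \<Rightarrow> real\<close>, which is second countable and metrizable; this makes
    \<open>Z\<close> hereditarily Lindelof and completely regular.\<close>
  define z :: "(nat \<Rightarrow> nat) \<Rightarrow> 'b \<times> (nat \<Rightarrow> real)" where "z d = (snd (p d), indicator (S d))" for d
  define P where "P = {(y, indicator (- F)) | y F. y \<in> topspace Y \<and> finite F} \<union> z ` D"
  define Z where "Z = subtopology (prod_topology Y (euclidean :: (nat \<Rightarrow> real) topology)) P"
  have P: "\<exists>y A. q = (y, indicator A) \<and> y \<in> topspace Y \<and> infinite A" if "q \<in> P" for q
  proof -
    have "infinite (- F)" if "finite F" for F :: "nat set" using that by (simp add: Compl_eq_Diff_UNIV)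
    moreover have "snd (p d) \<in> topspace Y" for d using p(1)[of d] by (auto simp: topspace_prod_topology)
    ultimately show ?thesis using that inf_S unfolding P_def z_def by blast
  qed
  have top_Z: "topspace Z = P"
    using P unfolding Z_def topspace_subtopology topspace_prod_topology by fastforce
  have hL_Z: "hereditarily_Lindelof_space Z"
    unfolding Z_def
    by (intro hereditarily_Lindelof_space_subtopology hereditarily_Lindelof_space_prod_second_countable Y(2))
  have "infinite P"
  proof
    assume "finite P"
    then have "finite (fst ` P)" by simp
    moreover have "topspace Y \<subseteq> fst ` P"
    proof
      fix y assume "y \<in> topspace Y"
      then have "(y, indicator (- {})) \<in> P" unfolding P_def using finite.emptyI by blast
      then show "y \<in> fst ` P" by (metis fst_conv imageI)
    qed
    ultimately have "finite (topspace Y)" by (rule finite_subset[rotated])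
    then show False using Y(1) by (simp add: infinite_Tychonoff_space_def)
  qed
  moreover have "completely_regular_space Z" "Hausdorff_space Z"
    using Y(1) unfolding infinite_Tychonoff_space_def Z_def
    by (simp_all add: completely_regular_space_subtopology completely_regular_space_prod_topology
        Hausdorff_space_subtopology Hausdorff_space_prod_topology
        metrizable_imp_completely_regular_space metrizable_space_euclidean)
  ultimately have Tych_Z: "infinite_Tychonoff_space Z"
    by (simp add: infinite_Tychonoff_space_def top_Z)

  \<comment> \<open>The selection has two halves. \<open>\<F>1\<close> catches every pair whose set
    contains \<open>{n..<h n}\<close> for \<open>U\<close>-many \<open>n\<close>. With
    \<open>d0\<close> dominating \<open>h\<close>, this settles the cofinite sets and all
    \<open>z d\<close> with \<open>d\<close> not before \<open>d0\<close>. The remaining points are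
    fewer than the dominating number and are caught by initial pieces of enumerated covers.\<close>
  have "Menger_space Z"
    unfolding Menger_space_def
  proof (intro allI impI)
    fix \<C> :: "nat \<Rightarrow> _" assume \<C>: "\<forall>n. open_cover Z (\<C> n)"
    define \<V> where "\<V> n = {T. openin (prod_topology Y euclidean) T \<and> T \<inter> P \<in> \<C> n}" for n
    have op: "openin (prod_topology Y euclidean) V" if "V \<in> \<V> n" for V n
      using that by (simp add: \<V>_def)
    have cov: "\<exists>V\<in>\<V> n. (y, indicator (- F)) \<in> V" if y: "y \<in> topspace Y" "finite F" for n y F
    proof -
      have "(y, indicator (- F)) \<in> \<Union>(\<C> n)"
        using \<C> y unfolding open_cover_def top_Z P_def by blast
      then obtain C where C: "C \<in> \<C> n" "(y, indicator (- F)) \<in> C" by blast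
      then have "openin Z C" using \<C> unfolding open_cover_def by blast
      then obtain T where "openin (prod_topology Y euclidean) T" "C = T \<inter> P"
        unfolding Z_def openin_subtopology by blast
      then show ?thesis using C unfolding \<V>_def by blast
    qed
    have "\<exists>\<F>1 h. (\<forall>n. finite (\<F>1 n) \<and> \<F>1 n \<subseteq> \<V> n) \<and>
        (\<forall>y\<in>topspace Y. \<forall>\<^sub>F n in U. \<forall>S. {n..<h n} \<subseteq> S \<longrightarrow> (y, indicator S) \<in> \<Union>(\<F>1 n))"
      by (rule U_Menger_space_interval_cover[OF Y(3)]) (erule op, rule cov)
    then obtain \<F>1 h where \<F>1: "\<forall>n. finite (\<F>1 n) \<and> \<F>1 n \<subseteq> \<V> n"
      and h: "\<forall>y\<in>topspace Y.
         \<forall>\<^sub>F n in U. \<forall>S. {n..<h n} \<subseteq> S \<longrightarrow> (y, indicator S) \<in> \<Union>(\<F>1 n)"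
      by (elim exE conjE) (rule that)
    obtain d0 where d0: "d0 \<in> D" "\<forall>\<^sub>F n in sequentially. h n \<le> d0 n"
      using D(1) unfolding dominating_def by blast
    have "P \<noteq> {}" using \<open>infinite P\<close> by auto
    then have "\<exists>c :: nat \<Rightarrow> nat \<Rightarrow> _. \<forall>n. range (c n) \<subseteq> \<C> n \<and> \<Union>(range (c n)) = P"
      using Lindelof_space_sequence_covers[OF hereditarily_Lindelof_imp_Lindelof_space[OF hL_Z] _ \<C>]
      unfolding top_Z by blast
    then obtain c :: "nat \<Rightarrow> nat \<Rightarrow> _" where c: "\<forall>n. range (c n) \<subseteq> \<C> n \<and> \<Union>(range (c n)) = P" ..
    \<comment> \<open>\<open>k d\<close> records where the enumerated covers catch
      \<open>z d\<close>; a \<open>g\<close> that exceeds \<open>k d\<close> just once catches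
      it.\<close>
    define k where "k d n = (LEAST i. z d \<in> c n i)" for d n
    have k: "z d \<in> c n (k d n)" if "d \<in> D" for d n
      unfolding k_def by (rule LeastI_ex) (use c[THEN spec, of n] that P_def in blast)
    have "|k ` underS ?r d0| <o dominating_number"
      using ordLeq_ordLess_trans[OF card_of_image small[OF d0(1)]] by (simp add: D(2))
    then obtain g where g: "\<And>d. d \<in> underS ?r d0 \<Longrightarrow> \<exists>n. k d n < g n"
      using card_less_dominating_number by (metis imageI)
    define \<F> where "\<F> n = (\<lambda>T. T \<inter> P) ` \<F>1 n \<union> c n ` {..<g n}" for n
    have "finite (\<F> n) \<and> \<F> n \<subseteq> \<C> n" for n
      using \<F>1[THEN spec, of n] c[THEN spec, of n] unfolding \<F>_def \<V>_def by auto
    moreover have "\<exists>n. q \<in> \<Union>(\<F> n)" if q: "q \<in> P" for q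
    proof -
      have interval: "\<exists>n. (y, indicator A) \<in> \<Union>(\<F> n)"
        if "(y, indicator A) \<in> P" "y \<in> topspace Y" "\<forall>\<^sub>F n in U. {n..<h n} \<subseteq> A" for y A
      proof -
        have "\<forall>\<^sub>F n in U. (y, indicator A) \<in> \<Union>(\<F>1 n)"
          using bspec[OF h that(2)] that(3) by eventually_elim blast
        from eventually_happens'[OF Ubot this] obtain n where "(y, indicator A) \<in> \<Union>(\<F>1 n)" ..
        then show ?thesis using that(1) unfolding \<F>_def by blast
      qed
      have ord: "(d0, d) \<in> ?r \<or> d \<in> underS ?r d0" if "d \<in> D" for d
      proof -
        have "total_on D ?r" "(d, d) \<in> ?r"
          using wo that unfolding well_order_on_def linear_order_on_def partial_order_on_def
            preorder_on_def refl_on_def by auto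
        then have "d = d0 \<or> (d0, d) \<in> ?r \<or> (d, d0) \<in> ?r"
          using that d0(1) unfolding total_on_def by metis
        then show ?thesis using \<open>(d, d) \<in> ?r\<close> by (auto simp: underS_def)
      qed
      have "(\<exists>y F. q = (y, indicator (- F)) \<and> y \<in> topspace Y \<and> finite F) \<or> (\<exists>d\<in>D. q = z d)"
        using q by (auto simp: P_def)
      then consider y F where "q = (y, indicator (- F))" "y \<in> topspace Y" "finite F"
        | d where "q = z d" "d \<in> D" "(d0, d) \<in> ?r" | d where "q = z d" "d \<in> underS ?r d0"
        using ord by metis
      then show ?thesis
      proof cases
        case 1
        have "\<forall>\<^sub>F n in sequentially. {n..<h n} \<subseteq> - F"
        proof -
          obtain m where "\<forall>i\<in>F. i < m" using 1(3) unfolding finite_nat_set_iff_bounded ..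
          then show ?thesis by (intro eventually_sequentiallyI[of m]) fastforce
        qed
        then have "\<forall>\<^sub>F n in U. {n..<h n} \<subseteq> - F" using Ucof by (rule filter_leD[rotated])
        then show ?thesis using interval[of y "- F"] 1 q by simp
      next
        case 2
        \<comment> \<open>For \<open>U\<close>-many \<open>n\<close>,
          \<open>h n \<le> d0 n \<le> e d n\<close> while \<open>S d\<close> contains
          \<open>{n..<e d n}\<close>.\<close>
        have "\<forall>\<^sub>F n in U. h n \<le> d0 n" using Ucof d0(2) by (rule filter_leD)
        with e[OF 2(2,3)] S[of d] have "\<forall>\<^sub>F n in U. {n..<h n} \<subseteq> S d"
          by eventually_elim force
        moreover have "snd (p d) \<in> topspace Y" using p(1)[of d] by (auto simp: topspace_prod_topology)
        ultimately show ?thesis using interval[of "snd (p d)" "S d"] 2(1) q by (simp add: z_def)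
      next
        case 3
        then have "d \<in> D" using wo(2) by (auto simp: underS_def Field_def)
        obtain n where "k d n < g n" using g 3(2) by blast
        then show ?thesis using k[OF \<open>d \<in> D\<close>, of n] 3(1) unfolding \<F>_def by blast
      qed
    qed
    ultimately show "\<exists>\<F>. (\<forall>n. finite (\<F> n) \<and> \<F> n \<subseteq> \<C> n) \<and> (\<forall>x\<in>topspace Z. \<exists>n. x \<in> \<Union>(\<F> n))"
      unfolding top_Z by blast
  qed
  then have Menger_XZ: "Menger_space (prod_topology X Z)"
    by (rule productively_Menger_in_hLD[OF X Tych_Z hL_Z])

  let ?XZ = "prod_topology X Z"
  \<comment> \<open>Membership of \<open>j\<close> in the coded set is expressed by positivity, an
    open condition. As the coded sets are infinite, some \<open>j \<ge> n\<close> is always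
    available, so for each \<open>n\<close> the sets \<open>W n m\<close> cover; they grow with
    \<open>m\<close>.\<close>
  define W where "W n m = {q \<in> topspace ?XZ. \<exists>j\<ge>n. 0 < snd (snd q) j \<and> f (fst q, fst (snd q)) j \<le> m}"
    for n m
  have contY: "continuous_map ?XZ ?XY (\<lambda>q. (fst q, fst (snd q)))"
    and contT: "continuous_map ?XZ euclidean (\<lambda>q. snd (snd q) j)" for j
  proof -
    have Z1: "continuous_map Z Y fst" and Z2: "continuous_map Z euclidean snd"
      unfolding Z_def by (simp_all add: continuous_map_from_subtopology continuous_map_fst continuous_map_snd)
    have sndq: "continuous_map ?XZ Z snd" by (rule continuous_map_snd)
    show "continuous_map ?XZ ?XY (\<lambda>q. (fst q, fst (snd q)))"
      using continuous_map_compose[OF sndq Z1]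
      by (intro continuous_map_pairedI continuous_map_fst) (simp add: comp_def)
    have "continuous_map euclidean euclidean (\<lambda>s :: nat \<Rightarrow> real. s j)"
      by (simp add: continuous_on_product_coordinates)
    from continuous_map_compose[OF continuous_map_compose[OF sndq Z2] this]
    show "continuous_map ?XZ euclidean (\<lambda>q. snd (snd q) j)" by (simp add: comp_def)
  qed
  have "openin ?XZ (W n m)" for n m
  proof -
    have "W n m = (\<Union>j\<in>{n..}. {q \<in> topspace ?XZ. (fst q, fst (snd q)) \<in> {p \<in> topspace ?XY. f p j \<le> m}}
        \<inter> {q \<in> topspace ?XZ. snd (snd q) j \<in> {0<..}})"
      using continuous_map_image_subset_topspace[OF contY] unfolding W_def by auto
    moreover have "openin ?XZ \<dots>"
      using openin_Int[OF openin_continuous_map_preimage[OF contY open_f]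
          openin_continuous_map_preimage[OF contT, of "{0<..}"]]
      by (intro openin_Union) auto
    ultimately show ?thesis by simp
  qed
  moreover have "\<Union>(range (W n)) = topspace ?XZ" for n
  proof -
    have "\<exists>m. q \<in> W n m" if q: "q \<in> topspace ?XZ" for q
    proof -
      have "snd q \<in> P" using q top_Z by (auto simp: topspace_prod_topology)
      then obtain y A where A: "snd q = (y, indicator A)" "infinite A" using P by blast
      then obtain j where "j \<ge> n" "j \<in> A" by (metis infinite_nat_iff_unbounded_le)
      then have "q \<in> W n (f (fst q, fst (snd q)) j)"
        using q A(1) unfolding W_def by (auto intro!: exI[of _ j])
      then show ?thesis ..
    qed
    then show ?thesis by (auto simp: W_def)
  qed
  ultimately have "open_cover ?XZ (range (W n))" for n by (simp add: open_cover_def)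
  \<comment> \<open>Arbitrarily large catching indices are wanted because the domination by
    \<open>d\<close> below holds only from some \<open>k\<close> on.\<close>
  then obtain \<F> where \<F>: "\<And>n::nat. finite (\<F> n) \<and> \<F> n \<subseteq> range (W n)"
    "\<And>q k. q \<in> topspace ?XZ \<Longrightarrow> \<exists>n\<ge>k. q \<in> \<Union>(\<F> n)"
    using Menger_space_infinitely_often[OF Menger_XZ, of "\<lambda>n. range (W n)"] by metis
  have "\<exists>m. \<Union>(\<F> n) \<subseteq> W n m" for n
  proof -
    obtain M where M: "finite M" "\<F> n = W n ` M"
      using \<F>(1)[of n] finite_subset_image[of "\<F> n" "W n" UNIV] by auto
    have "W n i \<subseteq> W n (Max M)" if "i \<in> M" for i
    proof -
      have "i \<le> Max M" using M(1) that by simp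
      then show ?thesis unfolding W_def by (auto intro: order_trans)
    qed
    then have "\<Union>(\<F> n) \<subseteq> W n (Max M)" unfolding M(2) by (rule UN_least)
    then show ?thesis ..
  qed
  then obtain g where g: "\<And>n. \<Union>(\<F> n) \<subseteq> W n (g n)" by metis
  \<comment> \<open>Partial sums turn \<open>g\<close> into a nondecreasing function, so that
    domination at some \<open>j \<ge> n\<close> still controls \<open>g n\<close>.\<close>
  obtain d where d: "d \<in> D" "\<forall>\<^sub>F n in sequentially. (\<Sum>i\<le>n. g i) \<le> d n"
    using D(1)[unfolded dominating_def, THEN spec, of "\<lambda>n. \<Sum>i\<le>n. g i"] by blast
  then obtain k where k: "\<And>n. n \<ge> k \<Longrightarrow> (\<Sum>i\<le>n. g i) \<le> d n"
    by (auto simp: eventually_sequentially)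
  have "(fst (p d), z d) \<in> topspace ?XZ"
    using p(1)[of d] d(1) top_Z P_def by (auto simp: topspace_prod_topology)
  then obtain n where "n \<ge> k" "(fst (p d), z d) \<in> W n (g n)" using \<F>(2) g by blast
  \<comment> \<open>At this \<open>j\<close> two facts collide:
    \<open>f (p d) j \<le> g n \<le> d j\<close>, and \<open>d j < f (p d) j\<close> because
    \<open>j \<in> S d\<close>.\<close>
  then obtain j where j: "j \<ge> n" "j \<in> S d" "f (p d) j \<le> g n"
    by (auto simp: W_def z_def indicator_def split: if_splits)
  have "g n \<le> (\<Sum>i\<le>j. g i)" by (rule member_le_sum) (use j in auto)
  also have "\<dots> \<le> d j" using k j(1) \<open>n \<ge> k\<close> by simp
  also have "\<dots> < f (p d) j" using j(2) by (simp add: S_def)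
  finally show False using j(3) by simp
qed

section \<open>From bounded functions to a \<open>U\<close>-Menger selection\<close>

theorem theorem4p4:
  fixes X :: "'a topology"
  assumes "infinite_Tychonoff_space X"
    and "productively_Menger_in_hL TYPE(real) X"
  shows "\<forall>U. free_ultrafilter U \<and> b_U U =o dominating_number \<longrightarrow>
           productively_U_Menger_in_hL TYPE('b) U X"
  unfolding productively_U_Menger_in_hL_def
proof (intro allI impI, elim conjE)
  fix U and Y :: "'b topology"
  assume U: "free_ultrafilter U" "b_U U =o dominating_number"
    and Y: "infinite_Tychonoff_space Y" "hereditarily_Lindelof_space Y" "U_Menger_space U Y"
  let ?XY = "prod_topology X Y"
  have "U \<noteq> bot" using U(1) by (simp add: free_ultrafilter_def)
  then have "Menger_space ?XY"
    by (intro productively_Menger_in_hLD[OF assms(2) Y(1,2)] U_Menger_imp_Menger_space[OF Y(3)])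
  then have Lind: "Lindelof_space ?XY" by (rule Menger_imp_Lindelof_space)
  have ne: "topspace ?XY \<noteq> {}"
    using assms(1) Y(1) by (auto simp: infinite_Tychonoff_space_def topspace_prod_topology)
  show "U_Menger_space U ?XY"
    unfolding U_Menger_space_def
  proof (intro allI impI)
    fix \<C> :: "nat \<Rightarrow> _" assume \<C>: "\<forall>n. open_cover ?XY (\<C> n)"
    obtain c :: "nat \<Rightarrow> nat \<Rightarrow> _" where "\<forall>n. range (c n) \<subseteq> \<C> n \<and> \<Union>(range (c n)) = topspace ?XY"
      using Lindelof_space_sequence_covers[OF Lind ne \<C>] ..
    then have c: "range (c n) \<subseteq> \<C> n" "\<Union>(range (c n)) = topspace ?XY" for n by simp_all
    have c_open: "openin ?XY (c n i)" for n i
      using c(1)[of n] \<C> unfolding open_cover_def by blast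
    \<comment> \<open>Requiring all covers up to \<open>n\<close>, not only the \<open>n\<close>-th,
      makes \<open>f p\<close> nondecreasing.\<close>
    define f where "f p n = (LEAST m. \<forall>n'\<le>n. \<exists>i\<le>m. p \<in> c n' i)" for p n
    have f_le: "f p n \<le> m \<longleftrightarrow> (\<forall>n'\<le>n. \<exists>i\<le>m. p \<in> c n' i)" if p: "p \<in> topspace ?XY" for p n m
    proof
      have "\<forall>n'. \<exists>i. p \<in> c n' i" using p c(2) by blast
      then obtain i where i: "\<And>n'. p \<in> c n' (i n')" by metis
      have "i n' \<le> (\<Sum>n'\<le>n. i n')" if "n' \<le> n" for n'
        by (rule member_le_sum) (use that in auto)
      then have "\<exists>m. \<forall>n'\<le>n. \<exists>i\<le>m. p \<in> c n' i" using i by blast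
      then have *: "\<forall>n'\<le>n. \<exists>i\<le>f p n. p \<in> c n' i"
        unfolding f_def by (rule LeastI_ex)
      show "\<forall>n'\<le>n. \<exists>i\<le>m. p \<in> c n' i" if "f p n \<le> m"
        using * that by (meson order_trans)
      show "f p n \<le> m" if "\<forall>n'\<le>n. \<exists>i\<le>m. p \<in> c n' i"
        unfolding f_def using that by (rule Least_le)
    qed
    \<comment> \<open>Off the space \<open>LEAST\<close> has no witness; the value \<open>0\<close>
      there makes \<open>f' p\<close> monotone for every \<open>p\<close>.\<close>
    define f' where "f' p = (if p \<in> topspace ?XY then f p else (\<lambda>_. 0))" for p
    have "mono (f' p)" for p
    proof (cases "p \<in> topspace ?XY")
      case True
      then have "f p n \<le> f p n'" if "n \<le> n'" for n n'
        using f_le[OF True, of n' "f p n'"] f_le[OF True, of n "f p n'"] that by force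
      then show ?thesis using True by (auto simp: f'_def intro: monoI)
    qed (simp add: f'_def monoI)
    moreover have "openin ?XY {p \<in> topspace ?XY. f' p n \<le> m}" for n m
    proof -
      have "p \<in> topspace ?XY \<and> f' p n \<le> m \<longleftrightarrow> p \<in> (\<Inter>n'\<in>{..n}. \<Union>i\<in>{..m}. c n' i)" for p
      proof (cases "p \<in> topspace ?XY")
        case True
        then show ?thesis by (auto simp: f'_def f_le)
      next
        case False
        then have "p \<notin> c 0 i" for i using openin_subset[OF c_open] by blast
        then show ?thesis using False by auto
      qed
      then have "{p \<in> topspace ?XY. f' p n \<le> m} = (\<Inter>n'\<in>{..n}. \<Union>i\<in>{..m}. c n' i)"
        by blast
      moreover have "openin ?XY \<dots>"
        by (intro openin_INT2 openin_Union) (auto simp: c_open)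
      ultimately show ?thesis by simp
    qed
    ultimately obtain h where h: "\<And>p. p \<in> topspace ?XY \<Longrightarrow> \<forall>\<^sub>F n in U. f' p n \<le> h n"
      using productively_Menger_imp_U_bounded[OF assms(2) Y U, of f'] by blast
    show "\<exists>\<F>. (\<forall>n. finite (\<F> n) \<and> \<F> n \<subseteq> \<C> n) \<and> (\<forall>p\<in>topspace ?XY. \<forall>\<^sub>F n in U. p \<in> \<Union>(\<F> n))"
    \<comment> \<open>\<open>f' p n \<le> h n\<close> puts \<open>p\<close> into one of the first
      \<open>h n + 1\<close> listed members of the \<open>n\<close>-th cover.\<close>
    proof (intro exI[of _ "\<lambda>n. c n ` {..h n}"] conjI allI ballI)
      show "c n ` {..h n} \<subseteq> \<C> n" for n using c(1) by blast
      fix p assume p: "p \<in> topspace ?XY"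
      show "\<forall>\<^sub>F n in U. p \<in> \<Union>(c n ` {..h n})"
        using h[OF p]
      proof (rule eventually_mono)
        fix n assume "f' p n \<le> h n"
        then have "\<exists>i\<le>h n. p \<in> c n i" using f_le[OF p] p by (simp add: f'_def)
        then show "p \<in> \<Union>(c n ` {..h n})" by blast
      qed
    qed simp
  qed
qed

end
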